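(* Let $S$ be a $\Gamma$-semigroup, let $\gamma_0 \in \Gamma$ be a fixed element, and let $\Sigma$ be the universal semigroup of $S$ (with respect to $\gamma_0$). For every $x \in S$, the quasi-ideal $(x)_q^{\Sigma}$ of $\Sigma$ generated by $x$ is $$(x)_{q}^{\Sigma} = (x)_{\ell}^{\Gamma} \cap (x)_{r}^{\Gamma} = (x)_{q}^{\Gamma},$$ where $(x)_{\ell}^{\Gamma} = S\Gamma x \cup \{x\}$, $(x)_{r}^{\Gamma} = x\Gamma S \cup \{x\}$ and $(x)_q^{\Gamma}$ are respectively the left ideal, the right ideal and the quasi-ideal of the $\Gamma$-semigroup $S$ generated by $x$.
   Context: Let $S$ and $\Gamma$ be non-empty sets. A $\Gamma$-semigroup is a set $S$ together with a map $S \times \Gamma \times S \to S$, $(a,\gamma,b) \mapsto a\gamma b$, such that $(a\alpha b)\beta c = a\alpha(b\beta c)$ for all $a,b,c \in S$ and $\alpha,\beta \in \Gamma$. For $A,B \subseteq S$ put $A\Gamma B = \{a\gamma b : a \in A,\ b \in B,\ \gamma \in \Gamma\}$, and write $x\Gamma S$, $S\Gamma x$ for $\{x\}\Gamma S$, $S\Gamma\{x\}$. A left (right) ideal of the $\Gamma$-semigroup $S$ is a non-empty subset $I$ with $S\Gamma I \subseteq I$ (resp. $I\Gamma S \subseteq I$). A quasi-ideal of the $\Gamma$-semigroup $S$ is a non-empty subset $Q \subseteq S$ with $Q\Gamma S \cap S\Gamma Q \subseteq Q$. A quasi-ideal of an ordinary semigroup $T$ is a non-empty subset $Q \subseteq T$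 with $QT \cap TQ \subseteq Q$. The quasi-ideal generated by $x$ is the smallest quasi-ideal containing $x$. The universal semigroup $\Sigma$ of $S$ (with respect to a fixed $\gamma_0 \in \Gamma$) is the quotient of the free semigroup $F$ on the disjoint union $S \cup \Gamma$ by the congruence generated by the relations $(\gamma_1,\gamma_2) \sim \gamma_1$, $(x,\gamma,y) \sim x\gamma y$, and $(x,y) \sim x\gamma_0 y$, for all $\gamma_1,\gamma_2,\gamma \in \Gamma$ and $x,y \in S$; here $(u_1,\dots,u_n)$ denotes a word in $F$ with letters $u_1,\dots,u_n$, and $x\gamma y$, $x\gamma_0 y$ on the right-hand sides are single letters in $S$. The canonical map $F \to \Sigma$ is injective on $S$ and on $\Gamma$, and elements of $S$ and $\Gamma$ are identified with their images in $\Sigma$. *)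

theory Defs
  imports Main
begin

section \<open>\<open>\<Gamma>\<close>-semigroups and their ideals\<close>

text \<open>\<open>act a \<gamma> b\<close> is the element written \<open>a\<gamma>b\<close>. The carriers are
  arbitrary sets; nothing is assumed about \<open>act\<close> outside of them.\<close>

locale gamma_semigroup =
  fixes S :: "'s set" and G :: "'g set" and act :: "'s \<Rightarrow> 'g \<Rightarrow> 's \<Rightarrow> 's"
  assumes S_nonempty: "S \<noteq> {}"
    and G_nonempty: "G \<noteq> {}"
    and act_closed: "\<lbrakk>a \<in> S; \<gamma> \<in> G; b \<in> S\<rbrakk> \<Longrightarrow> act a \<gamma> b \<in> S"
    and act_assoc: "\<lbrakk>a \<in> S; b \<in> S; c \<in> S; \<alpha> \<in> G; \<beta> \<in> G\<rbrakk>
      \<Longrightarrow> act (act a \<alpha> b) \<beta> c = act a \<alpha> (act b \<beta> c)"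

definition gamma_prod ::
    "'g set \<Rightarrow> ('s \<Rightarrow> 'g \<Rightarrow> 's \<Rightarrow> 's) \<Rightarrow> 's set \<Rightarrow> 's set \<Rightarrow> 's set" where
  "gamma_prod G act A B = {act a \<gamma> b | a \<gamma> b. a \<in> A \<and> \<gamma> \<in> G \<and> b \<in> B}"

definition gamma_left_ideal ::
    "'s set \<Rightarrow> 'g set \<Rightarrow> ('s \<Rightarrow> 'g \<Rightarrow> 's \<Rightarrow> 's) \<Rightarrow> 's set \<Rightarrow> bool" where
  "gamma_left_ideal S G act I \<longleftrightarrow> I \<noteq> {} \<and> I \<subseteq> S \<and> gamma_prod G act S I \<subseteq> I"

definition gamma_right_ideal ::
    "'s set \<Rightarrow> 'g set \<Rightarrow> ('s \<Rightarrow> 'g \<Rightarrow> 's \<Rightarrow> 's) \<Rightarrow> 's set \<Rightarrow> bool" where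
  "gamma_right_ideal S G act I \<longleftrightarrow> I \<noteq> {} \<and> I \<subseteq> S \<and> gamma_prod G act I S \<subseteq> I"

definition gamma_quasi_ideal ::
    "'s set \<Rightarrow> 'g set \<Rightarrow> ('s \<Rightarrow> 'g \<Rightarrow> 's \<Rightarrow> 's) \<Rightarrow> 's set \<Rightarrow> bool" where
  "gamma_quasi_ideal S G act Q \<longleftrightarrow>
     Q \<noteq> {} \<and> Q \<subseteq> S \<and> gamma_prod G act Q S \<inter> gamma_prod G act S Q \<subseteq> Q"

section \<open>Quasi-ideals of ordinary semigroups\<close>

definition semigroup_prod :: "('t \<Rightarrow> 't \<Rightarrow> 't) \<Rightarrow> 't set \<Rightarrow> 't set \<Rightarrow> 't set" where
  "semigroup_prod mul A B = {mul a b | a b. a \<in> A \<and> b \<in> B}"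

definition semigroup_quasi_ideal :: "'t set \<Rightarrow> ('t \<Rightarrow> 't \<Rightarrow> 't) \<Rightarrow> 't set \<Rightarrow> bool" where
  "semigroup_quasi_ideal T mul Q \<longleftrightarrow>
     Q \<noteq> {} \<and> Q \<subseteq> T \<and> semigroup_prod mul Q T \<inter> semigroup_prod mul T Q \<subseteq> Q"

section \<open>Generated ideals\<close>

text \<open>\<open>I\<close> is the smallest set with property \<open>P\<close> that contains \<open>x\<close>. This is a
  relation rather than a function so that it also asserts existence; such an \<open>I\<close> is
  unique.\<close>

definition is_generated_by :: "('a set \<Rightarrow> bool) \<Rightarrow> 'a \<Rightarrow> 'a set \<Rightarrow> bool" where
  "is_generated_by P x I \<longleftrightarrow> P I \<and> x \<in> I \<and> (\<forall>J. P J \<and> x \<in> J \<longrightarrow> I \<subseteq> J)"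

lemma is_generated_by_unique:
  "is_generated_by P x I \<Longrightarrow> is_generated_by P x J \<Longrightarrow> I = J"
  unfolding is_generated_by_def by blast

section \<open>The universal semigroup\<close>

text \<open>The free semigroup on the disjoint union of \<open>S\<close> and \<open>G\<close>, with concatenation
  as multiplication.\<close>

definition free_words :: "'s set \<Rightarrow> 'g set \<Rightarrow> ('s + 'g) list set" where
  "free_words S G = lists (S <+> G) - {[]}"

inductive_set universal_rels ::
    "'s set \<Rightarrow> 'g set \<Rightarrow> ('s \<Rightarrow> 'g \<Rightarrow> 's \<Rightarrow> 's) \<Rightarrow> 'g \<Rightarrow> (('s + 'g) list) rel"
  for S G act \<gamma>0 where
  gg: "\<lbrakk>\<gamma>1 \<in> G; \<gamma>2 \<in> G\<rbrakk> \<Longrightarrow> ([Inr \<gamma>1, Inr \<gamma>2], [Inr \<gamma>1]) \<in> universal_rels S G act \<gamma>0"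
| sgs: "\<lbrakk>x \<in> S; \<gamma> \<in> G; y \<in> S\<rbrakk>
    \<Longrightarrow> ([Inl x, Inr \<gamma>, Inl y], [Inl (act x \<gamma> y)]) \<in> universal_rels S G act \<gamma>0"
| ss: "\<lbrakk>x \<in> S; y \<in> S\<rbrakk> \<Longrightarrow> ([Inl x, Inl y], [Inl (act x \<gamma>0 y)]) \<in> universal_rels S G act \<gamma>0"

definition word_congruence :: "'a list set \<Rightarrow> 'a list rel \<Rightarrow> bool" where
  "word_congruence F C \<longleftrightarrow> equiv F C \<and>
     (\<forall>u u' v v'. (u, u') \<in> C \<and> (v, v') \<in> C \<longrightarrow> (u @ v, u' @ v') \<in> C)"

definition generated_congruence :: "'a list set \<Rightarrow> 'a list rel \<Rightarrow> 'a list rel" where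
  "generated_congruence F R = \<Inter> {C. word_congruence F C \<and> R \<subseteq> C}"

definition universal_cong ::
    "'s set \<Rightarrow> 'g set \<Rightarrow> ('s \<Rightarrow> 'g \<Rightarrow> 's \<Rightarrow> 's) \<Rightarrow> 'g \<Rightarrow> (('s + 'g) list) rel" where
  "universal_cong S G act \<gamma>0 = generated_congruence (free_words S G) (universal_rels S G act \<gamma>0)"

definition universal_semigroup ::
    "'s set \<Rightarrow> 'g set \<Rightarrow> ('s \<Rightarrow> 'g \<Rightarrow> 's \<Rightarrow> 's) \<Rightarrow> 'g \<Rightarrow> ('s + 'g) list set set" where
  "universal_semigroup S G act \<gamma>0 = free_words S G // universal_cong S G act \<gamma>0"

text \<open>The product of the classes of \<open>u\<close> and \<open>v\<close> is the class of \<open>u @ v\<close>; the union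
  ranges over copies of that one class (see \<open>universal_mult_class\<close> below).\<close>

definition universal_mult ::
    "'s set \<Rightarrow> 'g set \<Rightarrow> ('s \<Rightarrow> 'g \<Rightarrow> 's \<Rightarrow> 's) \<Rightarrow> 'g \<Rightarrow>
     ('s + 'g) list set \<Rightarrow> ('s + 'g) list set \<Rightarrow> ('s + 'g) list set" where
  "universal_mult S G act \<gamma>0 X Y = (\<Union>u\<in>X. \<Union>v\<in>Y. universal_cong S G act \<gamma>0 `` {u @ v})"

text \<open>The canonical map restricted to \<open>S\<close>, by which \<open>x\<close> is identified with its image.\<close>

definition universal_incl ::
    "'s set \<Rightarrow> 'g set \<Rightarrow> ('s \<Rightarrow> 'g \<Rightarrow> 's \<Rightarrow> 's) \<Rightarrow> 'g \<Rightarrow> 's \<Rightarrow> ('s + 'g) list set" where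
  "universal_incl S G act \<gamma>0 x = universal_cong S G act \<gamma>0 `` {[Inl x]}"

lemma free_words_append:
  "u \<in> free_words S G \<Longrightarrow> v \<in> free_words S G \<Longrightarrow> u @ v \<in> free_words S G"
  by (auto simp: free_words_def)

lemma (in gamma_semigroup) universal_rels_subset:
  assumes "\<gamma>0 \<in> G"
  shows "universal_rels S G act \<gamma>0 \<subseteq> free_words S G \<times> free_words S G"
  using assms act_closed by (fastforce simp: free_words_def elim: universal_rels.cases)

lemma word_congruence_Inter:
  assumes "\<C> \<noteq> {}" and "\<And>C. C \<in> \<C> \<Longrightarrow> word_congruence F C"
  shows "word_congruence F (\<Inter> \<C>)"
proof -
  have e: "equiv F C" if "C \<in> \<C>" for C
    using assms(2)[OF that] by (simp add: word_congruence_def)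
  have "equiv F (\<Inter> \<C>)"
  proof (rule equivI)
    show "\<Inter> \<C> \<subseteq> F \<times> F" using assms(1) e by (auto dest!: equiv_type)
    show "refl_on F (\<Inter> \<C>)"
      using e by (auto simp: refl_on_def equiv_def)
    show "sym (\<Inter> \<C>)" using e by (auto simp: sym_def equiv_def)
    show "trans (\<Inter> \<C>)" using e unfolding equiv_def trans_def by blast
  qed
  then show ?thesis
    using assms(2) unfolding word_congruence_def by blast
qed

lemma (in gamma_semigroup) universal_cong_congruence:
  assumes "\<gamma>0 \<in> G"
  shows "word_congruence (free_words S G) (universal_cong S G act \<gamma>0)"
    and "universal_rels S G act \<gamma>0 \<subseteq> universal_cong S G act \<gamma>0"
proof -
  let ?F = "free_words S G"
  have "equiv ?F (?F \<times> ?F)"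
    by (auto intro!: equivI simp: refl_on_def sym_def trans_def)
  then have "word_congruence ?F (?F \<times> ?F)"
    by (auto simp: word_congruence_def free_words_append)
  with universal_rels_subset[OF assms]
  have "{C. word_congruence ?F C \<and> universal_rels S G act \<gamma>0 \<subseteq> C} \<noteq> {}"
    by blast
  then show "word_congruence ?F (universal_cong S G act \<gamma>0)"
    unfolding universal_cong_def generated_congruence_def
    by (rule word_congruence_Inter) blast
  show "universal_rels S G act \<gamma>0 \<subseteq> universal_cong S G act \<gamma>0"
    unfolding universal_cong_def generated_congruence_def by blast
qed

lemma (in gamma_semigroup) universal_mult_class:
  assumes "\<gamma>0 \<in> G" and u: "u \<in> free_words S G" and v: "v \<in> free_words S G"
  shows "universal_mult S G act \<gamma>0
           (universal_cong S G act \<gamma>0 `` {u}) (universal_cong S G act \<gamma>0 `` {v})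
         = universal_cong S G act \<gamma>0 `` {u @ v}"
proof -
  let ?C = "universal_cong S G act \<gamma>0"
  have c: "word_congruence (free_words S G) ?C"
    by (rule universal_cong_congruence) fact
  then have e: "equiv (free_words S G) ?C"
    by (simp add: word_congruence_def)
  have "?C `` {u' @ v'} = ?C `` {u @ v}" if "(u, u') \<in> ?C" "(v, v') \<in> ?C" for u' v'
    using c that equiv_class_eq[OF e] unfolding word_congruence_def by blast
  moreover have "(u, u) \<in> ?C" "(v, v) \<in> ?C"
    using e u v by (auto simp: equiv_def refl_on_def)
  ultimately show ?thesis
    unfolding universal_mult_def by blast
qed

end

theory Submission
  imports Defs
begin

text \<open>In \<open>\<Sigma>\<close>, a word starting in a right ideal \<open>R\<close> of the \<open>\<Gamma>\<close>-semigroup collapses to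
  \<open>s\<close> or \<open>s\<gamma>\<close> with \<open>s \<in> R\<close>, and a word ending in a left ideal \<open>L\<close> collapses to \<open>t\<close> or
  \<open>\<gamma>t\<close> with \<open>t \<in> L\<close>. The elements \<open>s\<close>, \<open>s\<gamma>\<close>, \<open>\<gamma>s\<close> of \<open>\<Sigma>\<close> are pairwise distinct, and
  distinct for distinct \<open>s\<close>, so an element that is of both kinds lies in \<open>R \<inter> L\<close>. Hence
  \<open>R \<inter> L\<close> is a quasi-ideal of \<open>\<Sigma>\<close>. Conversely \<open>x\<gamma>s = t\<delta>x\<close> lies in both \<open>x\<Sigma>\<close> and
  \<open>\<Sigma>x\<close>, so it lies in every quasi-ideal of \<open>\<Sigma>\<close> that contains \<open>x\<close>.\<close>

lemma gamma_prodI: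
  "\<lbrakk>a \<in> A; \<gamma> \<in> G; b \<in> B\<rbrakk> \<Longrightarrow> act a \<gamma> b \<in> gamma_prod G act A B"
  by (auto simp: gamma_prod_def)

lemma gamma_prodE:
  assumes "y \<in> gamma_prod G act A B"
  obtains a \<gamma> b where "a \<in> A" "\<gamma> \<in> G" "b \<in> B" "y = act a \<gamma> b"
  using assms by (auto simp: gamma_prod_def)

lemma generated_congruence_least:
  "\<lbrakk>word_congruence F D; R \<subseteq> D\<rbrakk> \<Longrightarrow> generated_congruence F R \<subseteq> D"
  by (auto simp: generated_congruence_def)

section \<open>Principal left, right and quasi-ideals of a \<Gamma>-semigroup\<close>

context gamma_semigroup
begin

text \<open>Associativity turns \<open>act a \<alpha> (act c \<beta> x)\<close> into
  \<open>act (act a \<alpha> c) \<beta> x\<close>, which gives closure. The point \<open>x\<close>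
  is adjoined because it need not lie in S\<Gamma>x.\<close>

lemma left_ideal_generated:
  assumes "x \<in> S"
  shows "is_generated_by (gamma_left_ideal S G act) x (gamma_prod G act S {x} \<union> {x})"
proof -
  let ?L = "gamma_prod G act S {x} \<union> {x}"
  have "?L \<subseteq> S"
    using assms by (auto elim!: gamma_prodE intro: act_closed)
  moreover have "gamma_prod G act S ?L \<subseteq> ?L"
  proof
    fix y assume "y \<in> gamma_prod G act S ?L"
    then obtain a \<alpha> b where y: "a \<in> S" "\<alpha> \<in> G" "b \<in> ?L" "y = act a \<alpha> b"
      by (rule gamma_prodE)
    from y(3) show "y \<in> ?L"
    proof
      assume "b \<in> gamma_prod G act S {x}"
      then obtain c \<beta> where b: "c \<in> S" "\<beta> \<in> G" "b = act c \<beta> x"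
        by (auto elim: gamma_prodE)
      then have "y = act (act a \<alpha> c) \<beta> x"
        using y assms by (simp add: act_assoc)
      then show ?thesis
        using b y by (auto intro!: gamma_prodI act_closed)
    qed (use y in \<open>auto intro: gamma_prodI\<close>)
  qed
  moreover have "?L \<subseteq> J" if "gamma_left_ideal S G act J" "x \<in> J" for J
    using that unfolding gamma_left_ideal_def gamma_prod_def by blast
  ultimately show ?thesis
    by (auto simp: is_generated_by_def gamma_left_ideal_def)
qed

lemma right_ideal_generated:
  assumes "x \<in> S"
  shows "is_generated_by (gamma_right_ideal S G act) x (gamma_prod G act {x} S \<union> {x})"
proof -
  let ?R = "gamma_prod G act {x} S \<union> {x}"
  have "?R \<subseteq> S"
    using assms by (auto elim!: gamma_prodE intro: act_closed)
  moreover have "gamma_prod G act ?R S \<subseteq> ?R"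
  proof
    fix y assume "y \<in> gamma_prod G act ?R S"
    then obtain b \<alpha> a where y: "b \<in> ?R" "\<alpha> \<in> G" "a \<in> S" "y = act b \<alpha> a"
      by (rule gamma_prodE)
    from y(1) show "y \<in> ?R"
    proof
      assume "b \<in> gamma_prod G act {x} S"
      then obtain c \<beta> where b: "c \<in> S" "\<beta> \<in> G" "b = act x \<beta> c"
        by (auto elim: gamma_prodE)
      then have "y = act x \<beta> (act c \<alpha> a)"
        using y assms by (simp add: act_assoc)
      then show ?thesis
        using b y by (auto intro!: gamma_prodI act_closed)
    qed (use y in \<open>auto intro: gamma_prodI\<close>)
  qed
  moreover have "?R \<subseteq> J" if "gamma_right_ideal S G act J" "x \<in> J" for J
    using that unfolding gamma_right_ideal_def gamma_prod_def by blast
  ultimately show ?thesis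
    by (auto simp: is_generated_by_def gamma_right_ideal_def)
qed

text \<open>An element of the intersection other than \<open>x\<close> lies in both S\<Gamma>x and
  x\<Gamma>S, hence in S\<Gamma>J and J\<Gamma>S for every quasi-ideal \<open>J\<close> that
  contains \<open>x\<close>.\<close>

lemma quasi_ideal_generated:
  assumes "x \<in> S"
  shows "is_generated_by (gamma_quasi_ideal S G act) x
    ((gamma_prod G act S {x} \<union> {x}) \<inter> (gamma_prod G act {x} S \<union> {x}))"
proof -
  let ?L = "gamma_prod G act S {x} \<union> {x}" and ?R = "gamma_prod G act {x} S \<union> {x}"
  have L: "?L \<subseteq> S" "gamma_prod G act S ?L \<subseteq> ?L"
    using left_ideal_generated[OF assms]
    by (simp_all only: is_generated_by_def gamma_left_ideal_def)
  have R: "?R \<subseteq> S" "gamma_prod G act ?R S \<subseteq> ?R"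
    using right_ideal_generated[OF assms]
    by (simp_all only: is_generated_by_def gamma_right_ideal_def)
  have "gamma_prod G act (?L \<inter> ?R) S \<subseteq> gamma_prod G act ?R S"
    "gamma_prod G act S (?L \<inter> ?R) \<subseteq> gamma_prod G act S ?L"
    unfolding gamma_prod_def by blast+
  with L R have "gamma_quasi_ideal S G act (?L \<inter> ?R)"
    unfolding gamma_quasi_ideal_def by blast
  moreover have "?L \<inter> ?R \<subseteq> J" if J: "gamma_quasi_ideal S G act J" "x \<in> J" for J
  proof -
    have "gamma_prod G act S {x} \<subseteq> gamma_prod G act S J"
      "gamma_prod G act {x} S \<subseteq> gamma_prod G act J S"
      using J(2) unfolding gamma_prod_def by blast+
    then show ?thesis
      using J unfolding gamma_quasi_ideal_def by blast
  qed
  ultimately show ?thesis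
    by (simp add: is_generated_by_def)
qed

end

section \<open>The congruence defining the universal semigroup\<close>

locale pointed_gamma_semigroup = gamma_semigroup S G act
  for S :: "'s set" and G :: "'g set" and act :: "'s \<Rightarrow> 'g \<Rightarrow> 's \<Rightarrow> 's" +
  fixes \<gamma>0 :: 'g
  assumes point_in: "\<gamma>0 \<in> G"
begin

abbreviation "F \<equiv> free_words S G"
abbreviation "C \<equiv> universal_cong S G act \<gamma>0"
abbreviation "\<Sigma> \<equiv> universal_semigroup S G act \<gamma>0"
abbreviation "mul \<equiv> universal_mult S G act \<gamma>0"
abbreviation "\<iota> \<equiv> universal_incl S G act \<gamma>0"

lemma cong_equiv: "equiv F C"
  using universal_cong_congruence(1)[OF point_in] by (simp add: word_congruence_def)

lemma cong_refl: "u \<in> F \<Longrightarrow> (u, u) \<in> C"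
  using cong_equiv by (auto simp: equiv_def refl_on_def)

lemma cong_sym: "(u, v) \<in> C \<Longrightarrow> (v, u) \<in> C"
  using cong_equiv by (auto simp: equiv_def dest: symD)

lemma cong_trans: "(u, v) \<in> C \<Longrightarrow> (v, w) \<in> C \<Longrightarrow> (u, w) \<in> C"
  using cong_equiv by (auto simp: equiv_def dest: transD)

lemma cong_append: "(u, u') \<in> C \<Longrightarrow> (v, v') \<in> C \<Longrightarrow> (u @ v, u' @ v') \<in> C"
  using universal_cong_congruence(1)[OF point_in] by (auto simp: word_congruence_def)

lemma cong_rels: "(u, v) \<in> universal_rels S G act \<gamma>0 \<Longrightarrow> (u, v) \<in> C"
  using universal_cong_congruence(2)[OF point_in] by blast

lemma cong_eq: "(u, v) \<in> C \<Longrightarrow> C `` {u} = C `` {v}"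
  by (rule equiv_class_eq[OF cong_equiv])

lemma class_in: "u \<in> F \<Longrightarrow> C `` {u} \<in> \<Sigma>"
  by (simp add: universal_semigroup_def quotientI)

lemma universal_semigroupE:
  assumes "X \<in> \<Sigma>"
  obtains u where "u \<in> F" "X = C `` {u}"
  using assms by (auto simp: universal_semigroup_def elim: quotientE)

section \<open>An invariant of congruent words\<close>

text \<open>Words act from the right on pairs \<open>(s, p)\<close>: \<open>s\<close> is the product read so far and \<open>p\<close>
  the first letter of \<open>\<Gamma>\<close> read since the last letter of \<open>S\<close>. Letters of \<open>\<Gamma>\<close> before the
  first letter of \<open>S\<close> are forgotten.\<close>

fun scan :: "'s + 'g \<Rightarrow> 's option \<times> 'g option \<Rightarrow> 's option \<times> 'g option" where
  "scan (Inr \<gamma>) (s, None) = (s, Some \<gamma>)"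
| "scan (Inr \<gamma>) (s, Some \<delta>) = (s, Some \<delta>)"
| "scan (Inl y) (None, p) = (Some y, None)"
| "scan (Inl y) (Some s, None) = (Some (act s \<gamma>0 y), None)"
| "scan (Inl y) (Some s, Some \<delta>) = (Some (act s \<delta> y), None)"

text \<open>The laws for \<open>act\<close> hold only on the carriers, so words are compared only
  from states to which closure and associativity apply.\<close>

definition states :: "('s option \<times> 'g option) set" where
  "states = {(s, p). set_option s \<subseteq> S \<and> set_option p \<subseteq> G}"

lemma scan_closed: "\<sigma> \<in> states \<Longrightarrow> a \<in> S <+> G \<Longrightarrow> scan a \<sigma> \<in> states"
  by (cases "(a, \<sigma>)" rule: scan.cases) (auto simp: states_def point_in act_closed)

lemma fold_scan_closed:
  "\<sigma> \<in> states \<Longrightarrow> set u \<subseteq> S <+> G \<Longrightarrow> fold scan u \<sigma> \<in> states"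
  by (induction u arbitrary: \<sigma>) (simp_all add: scan_closed del: split_paired_All)

text \<open>The scan forgets leading letters of \<Gamma>, so the kind of the first letter is
  recorded separately. Comparing from all states, not just the empty one, makes the relation
  compatible with concatenation.\<close>

definition scan_cong :: "(('s + 'g) list) rel" where
  "scan_cong = {(u, v). u \<in> F \<and> v \<in> F \<and> isl (hd u) = isl (hd v) \<and>
     (\<forall>\<sigma>\<in>states. fold scan u \<sigma> = fold scan v \<sigma>)}"

text \<open>Words are non-empty, so \<open>u @ v\<close> starts with the first letter of
  \<open>u\<close>; and the scan of \<open>v\<close> begins in the state left by \<open>u\<close>,
  which is again in \<open>states\<close>.\<close>

lemma word_congruence_scan_cong: "word_congruence F scan_cong"
  unfolding word_congruence_def
proof (intro conjI allI impI)
  show "equiv F scan_cong"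
    by (auto simp: scan_cong_def intro!: equivI refl_onI symI transI)
  fix u u' v v'
  assume A: "(u, u') \<in> scan_cong \<and> (v, v') \<in> scan_cong"
  then have "u \<in> F" "u' \<in> F" "v \<in> F" "v' \<in> F"
    by (auto simp: scan_cong_def)
  moreover from this have "u \<noteq> []" "u' \<noteq> []" "set u \<subseteq> S <+> G" "set u' \<subseteq> S <+> G"
    by (auto simp: free_words_def)
  ultimately show "(u @ v, u' @ v') \<in> scan_cong"
    using A by (auto simp: scan_cong_def free_words_append fold_scan_closed)
qed

text \<open>The scan keeps only the first of consecutive letters of \<Gamma>, which settles
  \<open>gg\<close>. It inserts \<open>\<gamma>0\<close> between adjacent letters of
  \<open>S\<close>, so \<open>sgs\<close> and \<open>ss\<close> reduce to associativity once a
  product has been read.\<close>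

lemma universal_rels_scan_cong: "universal_rels S G act \<gamma>0 \<subseteq> scan_cong"
proof (rule subrelI)
  fix u v assume uv: "(u, v) \<in> universal_rels S G act \<gamma>0"
  then have "u \<in> F" "v \<in> F"
    using universal_rels_subset[OF point_in] by blast+
  moreover have "isl (hd u) = isl (hd v)"
    using uv by cases auto
  moreover have "fold scan u (s, p) = fold scan v (s, p)" if "(s, p) \<in> states" for s p
    using uv that
    by cases ((cases s; cases p; simp add: states_def act_assoc point_in)+)
  ultimately show "(u, v) \<in> scan_cong"
    by (auto simp: scan_cong_def)
qed

text \<open>\<open>C\<close> is the least congruence containing the defining relations, and
  \<open>scan_cong\<close> is another one.\<close>

lemma cong_scan: "(u, v) \<in> C \<Longrightarrow> (u, v) \<in> scan_cong"
  using generated_congruence_least[OF word_congruence_scan_cong universal_rels_scan_cong]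
  by (auto simp: universal_cong_def)

lemma cong_isl_hd: "(u, v) \<in> C \<Longrightarrow> isl (hd u) = isl (hd v)"
  by (auto simp: scan_cong_def dest: cong_scan)

lemma cong_fold_scan: "(u, v) \<in> C \<Longrightarrow> fold scan u (None, None) = fold scan v (None, None)"
  by (auto simp: scan_cong_def states_def dest: cong_scan)

section \<open>Normal forms of words that begin or end in an ideal\<close>

text \<open>Letters are absorbed one at a time at the right end: a letter of \<open>S\<close>
  multiplies \<open>s\<close>, and the product stays in \<open>R\<close>; a letter of \<Gamma> is
  kept after \<open>s\<close> and swallowed after an earlier letter of \<Gamma>.\<close>

lemma right_ideal_word:
  assumes R: "gamma_right_ideal S G act R" and "a \<in> R" and "set u \<subseteq> S <+> G"
  shows "\<exists>s\<in>R. (Inl a # u, [Inl s]) \<in> C \<or> (\<exists>\<gamma>\<in>G. (Inl a # u, [Inl s, Inr \<gamma>]) \<in> C)"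
  using assms(3)
proof (induction u rule: rev_induct)
  case Nil
  have "[Inl a] \<in> F"
    using R \<open>a \<in> R\<close> by (auto simp: free_words_def gamma_right_ideal_def)
  then show ?case
    using \<open>a \<in> R\<close> cong_refl by auto
next
  case (snoc c u)
  have closed: "act s \<gamma> y \<in> R" if "s \<in> R" "\<gamma> \<in> G" "y \<in> S" for s \<gamma> y
    using R that unfolding gamma_right_ideal_def by (blast intro: gamma_prodI)
  have c: "c \<in> S <+> G" and "set u \<subseteq> S <+> G"
    using snoc.prems by auto
  with snoc.IH obtain s where s: "s \<in> R"
    and u: "(Inl a # u, [Inl s]) \<in> C \<or> (\<exists>\<gamma>\<in>G. (Inl a # u, [Inl s, Inr \<gamma>]) \<in> C)"
    by auto
  have sS: "s \<in> S"
    using R s by (auto simp: gamma_right_ideal_def)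
  have refls: "([c], [c]) \<in> C" "([Inl s], [Inl s]) \<in> C"
    using c sS by (auto intro!: cong_refl simp: free_words_def)
  from u show ?case
  proof (elim disjE bexE)
    assume "(Inl a # u, [Inl s]) \<in> C"
    from cong_append[OF this refls(1)] have *: "(Inl a # u @ [c], [Inl s, c]) \<in> C"
      by simp
    from c show ?thesis
    proof
      fix y assume y: "c = Inl y" "y \<in> S"
      have "([Inl s, Inl y], [Inl (act s \<gamma>0 y)]) \<in> C"
        using sS y by (intro cong_rels universal_rels.ss)
      then show ?thesis
        using * y s closed point_in by (blast intro: cong_trans)
    next
      fix \<delta> assume "c = Inr \<delta>" "\<delta> \<in> G"
      then show ?thesis using * s by blast
    qed
  next
    fix \<gamma> assume \<gamma>: "\<gamma> \<in> G" and "(Inl a # u, [Inl s, Inr \<gamma>]) \<in> C"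
    from cong_append[OF this(2) refls(1)] have *: "(Inl a # u @ [c], [Inl s, Inr \<gamma>, c]) \<in> C"
      by simp
    from c show ?thesis
    proof
      fix y assume y: "c = Inl y" "y \<in> S"
      have "([Inl s, Inr \<gamma>, Inl y], [Inl (act s \<gamma> y)]) \<in> C"
        using sS y \<gamma> by (intro cong_rels universal_rels.sgs)
      then show ?thesis
        using * y s closed \<gamma> by (blast intro: cong_trans)
    next
      fix \<delta> assume \<delta>: "c = Inr \<delta>" "\<delta> \<in> G"
      have "([Inr \<gamma>, Inr \<delta>], [Inr \<gamma>]) \<in> C"
        using \<gamma> \<delta> by (intro cong_rels universal_rels.gg)
      from cong_append[OF refls(2) this] have "([Inl s, Inr \<gamma>, Inr \<delta>], [Inl s, Inr \<gamma>]) \<in> C"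
        by simp
      then show ?thesis
        using * \<delta> s \<gamma> by (blast intro: cong_trans)
    qed
  qed
qed

text \<open>The mirror image, absorbing letters at the left end. Since \<open>gg\<close> keeps the
  left letter, here the newly read letter of \<Gamma> replaces the earlier one.\<close>

lemma left_ideal_word:
  assumes L: "gamma_left_ideal S G act L" and "b \<in> L" and "set v \<subseteq> S <+> G"
  shows "\<exists>t\<in>L. (v @ [Inl b], [Inl t]) \<in> C \<or> (\<exists>\<gamma>\<in>G. (v @ [Inl b], [Inr \<gamma>, Inl t]) \<in> C)"
  using assms(3)
proof (induction v)
  case Nil
  have "[Inl b] \<in> F"
    using L \<open>b \<in> L\<close> by (auto simp: free_words_def gamma_left_ideal_def)
  then show ?case
    using \<open>b \<in> L\<close> cong_refl by auto
next
  case (Cons c v)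
  have closed: "act y \<gamma> t \<in> L" if "t \<in> L" "\<gamma> \<in> G" "y \<in> S" for t \<gamma> y
    using L that unfolding gamma_left_ideal_def by (blast intro: gamma_prodI)
  have c: "c \<in> S <+> G" and "set v \<subseteq> S <+> G"
    using Cons.prems by auto
  with Cons.IH obtain t where t: "t \<in> L"
    and v: "(v @ [Inl b], [Inl t]) \<in> C \<or> (\<exists>\<gamma>\<in>G. (v @ [Inl b], [Inr \<gamma>, Inl t]) \<in> C)"
    by auto
  have tS: "t \<in> S"
    using L t by (auto simp: gamma_left_ideal_def)
  have refls: "([c], [c]) \<in> C" "([Inl t], [Inl t]) \<in> C"
    using c tS by (auto intro!: cong_refl simp: free_words_def)
  from v show ?case
  proof (elim disjE bexE)
    assume "(v @ [Inl b], [Inl t]) \<in> C"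
    from cong_append[OF refls(1) this] have *: "((c # v) @ [Inl b], [c, Inl t]) \<in> C"
      by simp
    from c show ?thesis
    proof
      fix y assume y: "c = Inl y" "y \<in> S"
      have "([Inl y, Inl t], [Inl (act y \<gamma>0 t)]) \<in> C"
        using tS y by (intro cong_rels universal_rels.ss)
      then show ?thesis
        using * y t closed point_in by (blast intro: cong_trans)
    next
      fix \<delta> assume "c = Inr \<delta>" "\<delta> \<in> G"
      then show ?thesis using * t by blast
    qed
  next
    fix \<gamma> assume \<gamma>: "\<gamma> \<in> G" and "(v @ [Inl b], [Inr \<gamma>, Inl t]) \<in> C"
    from cong_append[OF refls(1) this(2)] have *: "((c # v) @ [Inl b], [c, Inr \<gamma>, Inl t]) \<in> C"
      by simp
    from c show ?thesis
    proof
      fix y assume y: "c = Inl y" "y \<in> S"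
      have "([Inl y, Inr \<gamma>, Inl t], [Inl (act y \<gamma> t)]) \<in> C"
        using tS y \<gamma> by (intro cong_rels universal_rels.sgs)
      then show ?thesis
        using * y t closed \<gamma> by (blast intro: cong_trans)
    next
      fix \<delta> assume \<delta>: "c = Inr \<delta>" "\<delta> \<in> G"
      have "([Inr \<delta>, Inr \<gamma>], [Inr \<delta>]) \<in> C"
        using \<gamma> \<delta> by (intro cong_rels universal_rels.gg)
      from cong_append[OF this refls(2)] have "([Inr \<delta>, Inr \<gamma>, Inl t], [Inr \<delta>, Inl t]) \<in> C"
        by simp
      then show ?thesis
        using * \<delta> t by (blast intro: cong_trans)
    qed
  qed
qed

section \<open>Quasi-ideals of the universal semigroup\<close>

text \<open>An element of both products is represented by a word beginning in \<open>R\<close> and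
  by one ending in \<open>L\<close>. Their normal forms are congruent, and the invariants force both
  to be the same single letter.\<close>

lemma universal_quasi_ideal_Int:
  assumes L: "gamma_left_ideal S G act L" and R: "gamma_right_ideal S G act R"
    and ne: "L \<inter> R \<noteq> {}"
  shows "semigroup_quasi_ideal \<Sigma> mul (\<iota> ` (L \<inter> R))"
  unfolding semigroup_quasi_ideal_def
proof (intro conjI)
  have word: "[Inl a] \<in> F" if "a \<in> L \<inter> R" for a
    using L that by (auto simp: free_words_def gamma_left_ideal_def)
  show "\<iota> ` (L \<inter> R) \<noteq> {}"
    using ne by simp
  show "\<iota> ` (L \<inter> R) \<subseteq> \<Sigma>"
    using word by (auto simp: universal_incl_def intro: class_in)
  show "semigroup_prod mul (\<iota> ` (L \<inter> R)) \<Sigma> \<inter> semigroup_prod mul \<Sigma> (\<iota> ` (L \<inter> R)) \<subseteq> \<iota> ` (L \<inter> R)"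
  proof
    fix X
    assume "X \<in> semigroup_prod mul (\<iota> ` (L \<inter> R)) \<Sigma> \<inter> semigroup_prod mul \<Sigma> (\<iota> ` (L \<inter> R))"
    then obtain a U V b where a: "a \<in> L \<inter> R" and U: "U \<in> \<Sigma>" and XU: "X = mul (\<iota> a) U"
      and b: "b \<in> L \<inter> R" and V: "V \<in> \<Sigma>" and XV: "X = mul V (\<iota> b)"
      by (auto simp: semigroup_prod_def)
    obtain u where u: "u \<in> F" "U = C `` {u}"
      using U by (rule universal_semigroupE)
    obtain v where v: "v \<in> F" "V = C `` {v}"
      using V by (rule universal_semigroupE)
    have Xu: "X = C `` {Inl a # u}"
      using universal_mult_class[OF point_in word[OF a] u(1)] XU u(2)
      by (simp add: universal_incl_def)
    have Xv: "X = C `` {v @ [Inl b]}"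
      using universal_mult_class[OF point_in v(1) word[OF b]] XV v(2)
      by (simp add: universal_incl_def)
    have "v @ [Inl b] \<in> F"
      using free_words_append[OF v(1) word[OF b]] .
    then have uv: "(Inl a # u, v @ [Inl b]) \<in> C"
      using Xu Xv eq_equiv_class[OF _ cong_equiv] by blast
    have sets: "set u \<subseteq> S <+> G" "set v \<subseteq> S <+> G"
      using u(1) v(1) by (auto simp: free_words_def)
    obtain s w where s: "s \<in> R" "(Inl a # u, w) \<in> C" "w = [Inl s] \<or> (\<exists>\<gamma>. w = [Inl s, Inr \<gamma>])"
      using right_ideal_word[OF R _ sets(1)] a by blast
    obtain t z where t: "t \<in> L" "(v @ [Inl b], z) \<in> C" "z = [Inl t] \<or> (\<exists>\<gamma>. z = [Inr \<gamma>, Inl t])"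
      using left_ideal_word[OF L _ sets(2)] b by blast
    have "(w, z) \<in> C"
      using s(2) t(2) uv by (blast intro: cong_trans cong_sym)
    \<comment> \<open>As \<open>w\<close> starts in \<open>S\<close>, so does \<open>z\<close>,
      hence \<open>z = [Inl t]\<close>. Its scan ends in \<open>(Some t, None)\<close>, whereas
      \<open>[Inl s, Inr \<gamma>]\<close> would leave a pending \<open>\<gamma>\<close>.\<close>
    from cong_isl_hd[OF this] cong_fold_scan[OF this] have "s = t" "w = [Inl s]"
      using s(3) t(3) by auto
    then have "X = \<iota> s"
      using Xu s(2) by (simp add: cong_eq universal_incl_def)
    then show "X \<in> \<iota> ` (L \<inter> R)"
      using s(1) t(1) \<open>s = t\<close> by blast
  qed
qed

lemma universal_quasi_ideal_generated:
  assumes x: "x \<in> S"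
  shows "is_generated_by (semigroup_quasi_ideal \<Sigma> mul) (\<iota> x)
    (\<iota> ` ((gamma_prod G act S {x} \<union> {x}) \<inter> (gamma_prod G act {x} S \<union> {x})))"
proof -
  let ?L = "gamma_prod G act S {x} \<union> {x}" and ?R = "gamma_prod G act {x} S \<union> {x}"
  have "semigroup_quasi_ideal \<Sigma> mul (\<iota> ` (?L \<inter> ?R))"
    using left_ideal_generated[OF x] right_ideal_generated[OF x]
    by (intro universal_quasi_ideal_Int) (auto simp: is_generated_by_def)
  moreover have "\<iota> ` (?L \<inter> ?R) \<subseteq> J"
    if J: "semigroup_quasi_ideal \<Sigma> mul J" and xJ: "\<iota> x \<in> J" for J
  proof
    fix Y assume "Y \<in> \<iota> ` (?L \<inter> ?R)"
    then obtain y where y: "y \<in> ?L \<inter> ?R" "Y = \<iota> y"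
      by blast
    show "Y \<in> J"
    proof (cases "y = x")
      case True
      then show ?thesis using y xJ by simp
    next
      case False
      \<comment> \<open>With \<open>x\<close> itself excluded, \<open>y\<close> lies in the product
        part of both \<open>?L\<close> and \<open>?R\<close>.\<close>
      then obtain t \<delta> s \<gamma> where t: "t \<in> S" "\<delta> \<in> G" "y = act t \<delta> x"
        and s: "s \<in> S" "\<gamma> \<in> G" "y = act x \<gamma> s"
        using y by (auto elim!: gamma_prodE)
      \<comment> \<open>The words x\<gamma>s and t\<delta>x are cut next to \<open>x\<close>; the
        remaining two letters form a single factor from \<open>\<Sigma>\<close>.\<close>
      have F: "[Inl x] \<in> F" "[Inl t, Inr \<delta>] \<in> F" "[Inr \<gamma>, Inl s] \<in> F"
        using x t s by (auto simp: free_words_def)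
      have "([Inl x, Inr \<gamma>, Inl s], [Inl y]) \<in> C"
        unfolding s(3) using x s by (intro cong_rels universal_rels.sgs)
      moreover have "([Inl t, Inr \<delta>, Inl x], [Inl y]) \<in> C"
        unfolding t(3) using x t by (intro cong_rels universal_rels.sgs)
      ultimately have "Y = mul (\<iota> x) (C `` {[Inr \<gamma>, Inl s]})" "Y = mul (C `` {[Inl t, Inr \<delta>]}) (\<iota> x)"
        using F y(2) by (simp_all add: universal_incl_def universal_mult_class point_in cong_eq)
      then have "Y \<in> semigroup_prod mul J \<Sigma>" "Y \<in> semigroup_prod mul \<Sigma> J"
        unfolding semigroup_prod_def using xJ F by (blast intro: class_in)+
      then show ?thesis
        using J by (auto simp: semigroup_quasi_ideal_def)
    qed
  qed
  ultimately show ?thesis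
    by (simp add: is_generated_by_def)
qed

end

text \<open>Generated ideals are unique, so each clause identifies the one in question with an
  explicit set. Taking the image under \<open>universal_incl\<close> expresses the identification of
  \<open>S\<close> with its image in the universal semigroup.\<close>

theorem corollary1p1:
  fixes S :: "'s set" and G :: "'g set" and act :: "'s \<Rightarrow> 'g \<Rightarrow> 's \<Rightarrow> 's"
    and \<gamma>0 :: 'g and x :: 's
  assumes "gamma_semigroup S G act" and "\<gamma>0 \<in> G" and "x \<in> S"
  shows "is_generated_by (gamma_left_ideal S G act) x (gamma_prod G act S {x} \<union> {x})
    \<and> is_generated_by (gamma_right_ideal S G act) x (gamma_prod G act {x} S \<union> {x})
    \<and> is_generated_by (gamma_quasi_ideal S G act) x
        ((gamma_prod G act S {x} \<union> {x}) \<inter> (gamma_prod G act {x} S \<union> {x}))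
    \<and> is_generated_by
        (semigroup_quasi_ideal (universal_semigroup S G act \<gamma>0) (universal_mult S G act \<gamma>0))
        (universal_incl S G act \<gamma>0 x)
        (universal_incl S G act \<gamma>0 `
          ((gamma_prod G act S {x} \<union> {x}) \<inter> (gamma_prod G act {x} S \<union> {x})))"
proof -
  interpret pointed_gamma_semigroup S G act \<gamma>0
    using assms(1,2) by (simp add: pointed_gamma_semigroup_def pointed_gamma_semigroup_axioms_def)
  show ?thesis
    using left_ideal_generated right_ideal_generated quasi_ideal_generated
      universal_quasi_ideal_generated assms(3) by blast
qed

end
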